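(* Let $X$ be a nonempty set and let $\mathcal{A}$ be a finite algebra of subsets of $X$. Then there exists a family $\mathcal{H}$ of subsets of $X$ such that $\mathcal{H}\subseteq\mathcal{A}$, $\mathcal{H}$ is $n$-minimal constructible for every $n\ge1$, and $C_\infty(\mathcal{H})=\mathcal{A}$.
   Context: An algebra of subsets of $X$ is a family closed under complements, finite unions and finite intersections. For a family $\mathcal{U}$ of subsets of $X$, let $C_1(\mathcal{U})$ be the family of all sets of the form $E_1\cap E_2$, $E_1\cup E_2$ or $X\setminus E_1$ with $E_1,E_2\in\mathcal{U}$ (possibly $E_1=E_2$). Set $C_0(\mathcal{U})=\mathcal{U}$, $C_n(\mathcal{U})=C_1(C_{n-1}(\mathcal{U}))$ for $n\ge1$, and $C_\infty(\mathcal{U})=\bigcup_{n\ge1}C_n(\mathcal{U})$. A family $\mathcal{U}$ is $n$-minimal constructible ($n\ge1$) if for every proper subfamily $\mathcal{H}\subsetneq\mathcal{U}$ we have $\mathcal{U}\not\subseteq C_n(\mathcal{H})$. *)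

theory Defs
  imports "HOL-Analysis.Sigma_Algebra"
begin

text \<open>
  Algebras of subsets of \<open>X\<close> are the library's \<open>algebra X\<close>: families of subsets of \<open>X\<close>
  that contain the empty set (the empty union), hence also \<open>X\<close>, and are closed under complement
  in \<open>X\<close>, union and intersection.

  The family \<open>C\<^sub>n(U)\<close> involves complements, so the ambient set \<open>X\<close> is an explicit argument below.
\<close>

definition constr_step :: "'a set \<Rightarrow> 'a set set \<Rightarrow> 'a set set" where
  "constr_step X U =
     {E1 \<inter> E2 | E1 E2. E1 \<in> U \<and> E2 \<in> U} \<union>
     {E1 \<union> E2 | E1 E2. E1 \<in> U \<and> E2 \<in> U} \<union>
     {X - E1 | E1. E1 \<in> U}"

primrec constr :: "'a set \<Rightarrow> nat \<Rightarrow> 'a set set \<Rightarrow> 'a set set" where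
  "constr X 0 U = U"
| "constr X (Suc n) U = constr_step X (constr X n U)"

definition constr_inf :: "'a set \<Rightarrow> 'a set set \<Rightarrow> 'a set set" where
  "constr_inf X U = (\<Union>n\<in>{1..}. constr X n U)"

text \<open>The notion is meant for \<open>n \<ge> 1\<close> only and for \<open>U \<subseteq> Pow X\<close>.\<close>

definition minimal_constructible :: "'a set \<Rightarrow> nat \<Rightarrow> 'a set set \<Rightarrow> bool" where
  "minimal_constructible X n U \<longleftrightarrow> (\<forall>H. H \<subset> U \<longrightarrow> \<not> U \<subseteq> constr X n H)"

end

(* An inclusion-minimal family H with C_inf(H) = A works, where A is finite: if H were contained in
   C_n(H') for a proper subfamily H', then C_m(H) would be contained in C_{m+n}(H') for all m, so
   H' would generate A as well. *)
theory Submission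
  imports Defs
begin

lemma constr_step_mono: "U \<subseteq> V \<Longrightarrow> constr_step X U \<subseteq> constr_step X V"
  unfolding constr_step_def by blast

lemma constr_mono: "U \<subseteq> V \<Longrightarrow> constr X n U \<subseteq> constr X n V"
  by (induction n) (simp_all add: constr_step_mono)

lemma constr_add: "constr X (m + n) U = constr X m (constr X n U)"
  by (induction m) simp_all

lemma constr_inf_mono: "U \<subseteq> V \<Longrightarrow> constr_inf X U \<subseteq> constr_inf X V"
  unfolding constr_inf_def using constr_mono[of U V X] by blast

text \<open>Running \<open>m\<close> steps on sets that are themselves obtained in \<open>n\<close>
  steps from \<open>V\<close> takes \<open>m + n\<close> steps from \<open>V\<close>. The index
  stays in the range of the union because \<open>m \<ge> 1\<close>, even if
  \<open>n = 0\<close>.\<close>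

lemma constr_inf_subset_if_subset_constr:
  assumes "U \<subseteq> constr X n V"
  shows "constr_inf X U \<subseteq> constr_inf X V"
proof
  fix S assume "S \<in> constr_inf X U"
  then obtain m where "m \<ge> 1" "S \<in> constr X m U"
    by (auto simp: constr_inf_def)
  with constr_mono[OF assms, of X m] have "S \<in> constr X (m + n) V" "m + n \<ge> 1"
    by (auto simp: constr_add)
  then show "S \<in> constr_inf X V"
    unfolding constr_inf_def by blast
qed

text \<open>The closure properties keep a step inside \<open>A\<close>; conversely no set is lost,
  as E = E \<inter> E and the two sets in a step may coincide.\<close>

lemma constr_step_algebra:
  assumes "algebra X A"
  shows "constr_step X A = A"
proof -
  interpret algebra X A by fact
  show ?thesis
    unfolding constr_step_def by auto
qed

lemma constr_inf_algebra:
  assumes "algebra X A"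
  shows "constr_inf X A = A"
proof -
  have "constr X n A = A" for n
    by (induction n) (simp_all add: constr_step_algebra[OF assms])
  then show ?thesis
    unfolding constr_inf_def by auto
qed

theorem theorem6p15:
  fixes X :: "'a set" and A :: "'a set set"
  assumes "X \<noteq> {}"
    and "algebra X A"
    and "finite A"
  shows "\<exists>H. H \<subseteq> Pow X \<and> H \<subseteq> A \<and>
           (\<forall>n\<ge>1. minimal_constructible X n H) \<and>
           constr_inf X H = A"
proof -
  \<comment> \<open>The subfamilies that generate \<open>A\<close>: finitely many, and
    \<open>A\<close> is one of them, so a minimal one exists.\<close>
  let ?G = "{H. H \<subseteq> A \<and> constr_inf X H = A}"
  have "finite ?G"
    using assms(3) by simp
  moreover have "?G \<noteq> {}"
    using constr_inf_algebra[OF assms(2)] by blast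
  ultimately obtain H where "H \<in> ?G" and minimal: "\<forall>K\<in>?G. K \<subseteq> H \<longrightarrow> H = K"
    by (rule finite_has_minimal[THEN bexE])
  then have H: "H \<subseteq> A" "constr_inf X H = A"
    by simp_all
  have "minimal_constructible X n H" for n
    unfolding minimal_constructible_def
  proof (intro allI impI notI)
    fix K assume K: "K \<subset> H" and "H \<subseteq> constr X n K"
    \<comment> \<open>Since \<open>K\<close> constructs \<open>H\<close>, it generates at least
      \<open>A\<close>; since it lies in \<open>H\<close>, it generates at most
      \<open>A\<close>.\<close>
    then have "constr_inf X K = A"
      using constr_inf_subset_if_subset_constr[of H X n K] constr_inf_mono[of K H X] H(2)
      by blast
    with K H(1) have "K \<in> ?G"
      by blast
    then have "H = K"
      using bspec[OF minimal] K psubset_imp_subset by metis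
    with K show False
      by simp
  qed
  moreover have "H \<subseteq> Pow X"
    using assms(2) H(1) by (auto simp: algebra_iff_Un)
  ultimately show ?thesis
    using H by (intro exI[of _ H]) simp
qed

end
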